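(* For all fixed integers $t\ge 2$ and $d\ge 2$, as $n\to\infty$, $$k_0(n,t,d)\le \frac{(t-1)\lg n}{\lg\left(\frac{d^t}{d^t-t}\right)}(1+o(1)).$$
   Context: $\lg$ denotes $\log_2$. The weight of a word of length $t$ over the alphabet $\{1,\dots,d\}$ is the sum of its $t$ entries, so weights range over the integers $w$ with $t\le w\le dt$. For $n\ge t$, a $k\times n$ array with entries from $\{1,\dots,d\}$ is a covering array for weight-equivalent words of length $t$ over $[d]=\{1,\dots,d\}$ if for each choice of $t$ columns and each integer $w$ with $t\le w\le dt$, a word of weight $w$ appears in at least one of the rows of the selected $t$ columns. $k_0(n,t,d)$ denotes the minimum number $k$ of rows for which such a $k\times n$ array exists. The term $o(1)$ denotes a quantity tending to $0$ as $n\to\infty$ with $t,d$ fixed. *)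

theory Defs
  imports Complex_Main "HOL-Library.FuncSet"
begin

(* A k x n array is a function A; only the entries A i j with i < k (rows) and j < n
   (columns) matter.  The weight of a word does not depend on the order of its letters, so a
   choice of t columns is a set C of t column indices. *)
definition word_weight :: "(nat \<Rightarrow> nat) \<Rightarrow> nat set \<Rightarrow> nat" where
  "word_weight x C = (\<Sum>j\<in>C. x j)"

definition weight_covering_array :: "nat \<Rightarrow> nat \<Rightarrow> nat \<Rightarrow> nat \<Rightarrow> (nat \<Rightarrow> nat \<Rightarrow> nat) \<Rightarrow> bool" where
  "weight_covering_array k n t d A \<longleftrightarrow>
     (\<forall>i<k. \<forall>j<n. A i j \<in> {1..d}) \<and>
     (\<forall>C w. C \<subseteq> {..<n} \<and> card C = t \<and> t \<le> w \<and> w \<le> d * t \<longrightarrow> (\<exists>i<k. word_weight (A i) C = w))"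

(* The minimum is over a nonempty set when d > 0, by weight_covering_array_exists below. *)
definition k0 :: "nat \<Rightarrow> nat \<Rightarrow> nat \<Rightarrow> nat" where
  "k0 n t d = (LEAST k. \<exists>A. weight_covering_array k n t d A)"

lemma word_of_weight_exists:
  assumes "finite C" "d > 0" "card C \<le> w" "w \<le> d * card C"
  shows "\<exists>f. (\<forall>j. f j \<in> {1..d}) \<and> word_weight f C = w"
  using assms(1,3,4)
proof (induction C arbitrary: w rule: finite_induct)
  case empty
  then show ?case using \<open>d > 0\<close> by (intro exI[of _ "\<lambda>_. 1"]) (auto simp: word_weight_def)
next
  case (insert x C)
  define a where "a = min d (w - card C)"
  have w: "Suc (card C) \<le> w" "w \<le> d + d * card C"
    using insert by auto
  have c: "card C \<le> d * card C" using \<open>d > 0\<close> by simp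
  have a: "a \<in> {1..d}" "card C \<le> w - a" "w - a \<le> d * card C" "a \<le> w"
    using w c \<open>d > 0\<close> unfolding a_def by (cases "d \<le> w - card C"; simp; linarith)+
  obtain f where f: "\<forall>j. f j \<in> {1..d}" "word_weight f C = w - a"
    using insert.IH[OF a(2,3)] by blast
  define g where "g = f(x := a)"
  have g: "\<forall>j. g j \<in> {1..d}"
    using f(1) a(1) by (simp add: g_def)
  have "(\<Sum>j\<in>C. g j) = (\<Sum>j\<in>C. f j)"
    using insert.hyps by (intro sum.cong) (auto simp: g_def)
  then have "word_weight g (insert x C) = w"
    using f(2) insert.hyps a(4) by (simp add: word_weight_def g_def)
  with g show ?case by blast
qed

lemma weight_covering_array_exists:
  assumes "d > 0"
  shows "\<exists>k A. weight_covering_array k n t d A"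
proof -
  define F where "F = {..<n} \<rightarrow>\<^sub>E {1..d}"
  have "finite F" by (simp add: F_def finite_PiE)
  then obtain h where "bij_betw h {0..<card F} F"
    using ex_bij_betw_nat_finite by blast
  then have h: "h ` {0..<card F} = F"
    by (rule bij_betw_imp_surj_on)
  define k where "k = card F"
  have "weight_covering_array k n t d h"
    unfolding weight_covering_array_def
  proof (intro conjI allI impI)
    fix i j assume "i < k" "j < n"
    have "i \<in> {0..<card F}" using \<open>i < k\<close> by (simp add: k_def)
    then have "h i \<in> F" using h by blast
    then show "h i j \<in> {1..d}"
      unfolding F_def by (rule PiE_mem) (simp add: \<open>j < n\<close>)
  next
    fix C w assume *: "C \<subseteq> {..<n} \<and> card C = t \<and> t \<le> w \<and> w \<le> d * t"
    then have C: "C \<subseteq> {..<n}" "card C \<le> w" "w \<le> d * card C" by simp_all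
    have "finite C" using C(1) by (rule finite_subset) simp
    then obtain f where f: "\<forall>j. f j \<in> {1..d}" "word_weight f C = w"
      using word_of_weight_exists[OF _ assms C(2,3)] by blast
    have "restrict f {..<n} \<in> F" unfolding F_def using f(1) by simp
    then have "restrict f {..<n} \<in> h ` {0..<card F}" by (simp only: h)
    then obtain i where i: "i < k" "h i = restrict f {..<n}"
      unfolding k_def by (metis atLeastLessThan_iff imageE)
    have "word_weight (h i) C = word_weight f C"
      unfolding word_weight_def i(2) using C(1) by (intro sum.cong) auto
    then show "\<exists>i<k. word_weight (h i) C = w" using i(1) f(2) by auto
  qed
  then show ?thesis by blast
qed

end

theory Submission
  imports Defs
begin

text \<open>
  The weights \<open>t\<close> and \<open>d * t\<close> are each the weight of a single word, so a random row meets them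
  only with probability \<open>1 / d ^ t\<close>; but the two constant rows \<open>1\<dots>1\<close> and \<open>d\<dots>d\<close> cover them for
  every choice of columns, at the cost of two rows.  Every weight strictly between is the weight
  of at least \<open>t\<close> words (\<open>card_words_of_weight_ge\<close>), so a uniformly random row misses it on given
  columns with probability at most \<open>q = 1 - t / d ^ t\<close>, and \<open>k\<close> independent rows all miss it with
  probability at most \<open>q ^ k\<close>.

  A union bound over all choices of \<open>t\<close> among \<open>n\<close> columns would need \<open>n ^ t * q ^ k\<close> to be small
  and would give the factor \<open>t\<close> in place of \<open>t - 1\<close>.  The remaining factor of \<open>n\<close> is saved by
  alteration: start with \<open>2 * n\<close> columns, allow up to \<open>n\<close> uncovered pairs of a column choice and a
  weight (\<open>array_with_few_uncovered\<close>), and delete one column from each of them (\<open>k0_le\<close>).  It is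
  enough that \<open>(2 * n) ^ t * (d * t) * q ^ k \<le> n\<close>, which holds from
  \<open>k = (t - 1) * lg n / lg (1 / q) + O(1)\<close> on, and the bounded term is absorbed by \<open>o(1)\<close>.
\<close>

section \<open>Words of a given weight\<close>

definition words_of_weight :: "nat \<Rightarrow> nat set \<Rightarrow> nat \<Rightarrow> (nat \<Rightarrow> nat) set" where
  "words_of_weight d C w = {f \<in> C \<rightarrow>\<^sub>E {1..d}. word_weight f C = w}"

lemma finite_words_of_weight [simp]: "finite C \<Longrightarrow> finite (words_of_weight d C w)"
  by (simp add: words_of_weight_def finite_PiE)

lemma card_words_of_weight_pos:
  assumes "finite C" "d > 0" "card C \<le> w" "w \<le> d * card C"
  shows "1 \<le> card (words_of_weight d C w)"
proof -
  obtain f where f: "\<forall>j. f j \<in> {1..d}" "word_weight f C = w"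
    using word_of_weight_exists[OF assms] by blast
  then have "restrict f C \<in> words_of_weight d C w"
    by (simp add: words_of_weight_def word_weight_def)
  then have "words_of_weight d C w \<noteq> {}" by blast
  then show ?thesis
    using assms(1) by (simp add: Suc_le_eq card_gt_0_iff)
qed

lemma card_words_of_weight_insert:
  assumes C: "finite C" "x \<notin> C"
    and ab: "a \<in> {1..d}" "b \<in> {1..d}" "a \<noteq> b" "a \<le> w" "b \<le> w"
  shows "card (words_of_weight d C (w - a)) + card (words_of_weight d C (w - b))
           \<le> card (words_of_weight d (insert x C) w)"
proof -
  define E where "E c = (\<lambda>f. f(x := c)) ` words_of_weight d C (w - c)" for c :: nat
  have card_E: "card (E c) = card (words_of_weight d C (w - c))" for c
    unfolding E_def
  proof (intro card_image inj_onI)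
    fix f g assume "f \<in> words_of_weight d C (w - c)" "g \<in> words_of_weight d C (w - c)"
      and eq: "f(x := c) = g(x := c)"
    then have "f x = g x"
      using C(2) by (auto simp: words_of_weight_def PiE_def extensional_def)
    with eq show "f = g" by (metis fun_upd_triv fun_upd_upd)
  qed
  have E_sub: "E c \<subseteq> words_of_weight d (insert x C) w" if c: "c \<in> {1..d}" "c \<le> w" for c
  proof
    fix g assume "g \<in> E c"
    then obtain f where f: "f \<in> C \<rightarrow>\<^sub>E {1..d}" "word_weight f C = w - c" and g: "g = f(x := c)"
      by (auto simp: E_def words_of_weight_def)
    have "(\<Sum>j\<in>C. g j) = (\<Sum>j\<in>C. f j)"
      using C(2) by (intro sum.cong) (auto simp: g)
    then have "word_weight g (insert x C) = w"
      using C c f(2) by (simp add: word_weight_def g)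
    moreover have "g \<in> insert x C \<rightarrow>\<^sub>E {1..d}"
      using f(1) c(1) unfolding g by (intro PiE_fun_upd) auto
    ultimately show "g \<in> words_of_weight d (insert x C) w"
      by (simp add: words_of_weight_def)
  qed
  have disj: "E a \<inter> E b = {}"
  proof -
    have "g x = c" if "g \<in> E c" for g c using that by (auto simp: E_def)
    with ab(3) show ?thesis by blast
  qed
  have "card (E a) + card (E b) = card (E a \<union> E b)"
    using C(1) disj by (intro card_Un_disjoint[symmetric]) (simp_all add: E_def)
  also have "\<dots> \<le> card (words_of_weight d (insert x C) w)"
    using E_sub ab C(1) by (intro card_mono) auto
  finally show ?thesis by (simp add: card_E)
qed

text \<open>
  Induction on the number of columns: one value of the new letter leaves a weight that is again
  strictly between the extremes and so contributes \<open>card C\<close> words, and a second value leaves an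
  attainable weight and contributes at least one more.  The bound is attained at weight
  \<open>card C + 1\<close>.
\<close>

lemma card_words_of_weight_ge:
  assumes "finite C" "d \<ge> 2" "card C < w" "w < d * card C"
  shows "card C \<le> card (words_of_weight d C w)"
  using assms(1,3,4)
proof (induction C arbitrary: w rule: finite_induct)
  case empty
  then show ?case by simp
next
  case (insert x C)
  define s where "s = card C"
  have ws: "s + 2 \<le> w" "w < d * s + d"
    using insert by (auto simp: s_def)
  have ge1: "1 \<le> card (words_of_weight d C v)" if "s \<le> v" "v \<le> d * s" for v
    using card_words_of_weight_pos[of C d v] insert.hyps \<open>d \<ge> 2\<close> that by (simp add: s_def)
  have ges: "s \<le> card (words_of_weight d C v)" if "s < v" "v < d * s" for v
    using insert.IH[of v] that by (simp add: s_def)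
  have "s + 1 \<le> card (words_of_weight d (insert x C) w)"
  proof (cases "s = 0")
    case True
    then show ?thesis
      using card_words_of_weight_pos[of "insert x C" d w] insert.hyps ws \<open>d \<ge> 2\<close>
      by (simp add: s_def)
  next
    case False
    then obtain r where r: "s = Suc r" by (cases s) auto
    have dr: "2 * r \<le> d * r" using \<open>d \<ge> 2\<close> by simp
    show ?thesis
    proof (cases "w \<le> d * s")
      case True
      have "s \<le> card (words_of_weight d C (w - 1))"
        using ws True by (intro ges) auto
      moreover have "1 \<le> card (words_of_weight d C (w - 2))"
        using ws True by (intro ge1) auto
      moreover have "card (words_of_weight d C (w - 1)) + card (words_of_weight d C (w - 2))
          \<le> card (words_of_weight d (insert x C) w)"
        using insert.hyps \<open>d \<ge> 2\<close> ws by (intro card_words_of_weight_insert) auto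
      ultimately show ?thesis by linarith
    next
      case big: False
      have w_gt: "d * r + d < w" using big r by simp
      have "s \<le> card (words_of_weight d C (w - d))"
      proof (cases "r = 0")
        \<comment> \<open>With one old column the remaining weight may be 1, the least attainable one, but then
            a single word suffices.\<close>
        case True
        then show ?thesis using ge1[of "w - d"] ws w_gt r by simp
      next
        case False
        then have "s < w - d" using w_gt r dr by linarith
        then show ?thesis using ws by (intro ges) auto
      qed
      moreover have "1 \<le> card (words_of_weight d C (w - (d - 1)))"
      proof (rule ge1)
        show "s \<le> w - (d - 1)" using w_gt r dr by linarith
        show "w - (d - 1) \<le> d * s" using ws \<open>d \<ge> 2\<close> by linarith
      qed
      moreover have "card (words_of_weight d C (w - d)) + card (words_of_weight d C (w - (d - 1)))
          \<le> card (words_of_weight d (insert x C) w)"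
        using insert.hyps \<open>d \<ge> 2\<close> w_gt by (intro card_words_of_weight_insert) auto
      ultimately show ?thesis by linarith
    qed
  qed
  then show ?case using insert.hyps by (simp add: s_def)
qed

lemma card_rows_of_weight:
  assumes V: "finite V" "C \<subseteq> V"
  shows "card {r \<in> V \<rightarrow>\<^sub>E {1..d}. word_weight r C = w}
           \<ge> card (words_of_weight d C w) * d ^ (card V - card C)"
proof -
  define merge where
    "merge = (\<lambda>(f, g). \<lambda>j. if j \<in> C then f j else g j :: nat)"
  define D where "D = words_of_weight d C w \<times> (V - C \<rightarrow>\<^sub>E {1..d})"
  have fin: "finite C" using V finite_subset by blast
  have inj: "inj_on merge D"
  proof (rule inj_onI, clarify)
    fix f g f' g' assume *: "(f, g) \<in> D" "(f', g') \<in> D" "merge (f, g) = merge (f', g')"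
    have eq: "(if j \<in> C then f j else g j) = (if j \<in> C then f' j else g' j)" for j
      using fun_cong[OF *(3), of j] by (simp add: merge_def)
    have fg: "f \<in> extensional C" "f' \<in> extensional C" "g \<in> extensional (V - C)"
        "g' \<in> extensional (V - C)"
      using *(1,2) by (auto simp: D_def words_of_weight_def PiE_def)
    have "f j = f' j" for j
      using eq[of j] fg by (cases "j \<in> C") (auto simp: extensional_def)
    moreover have "g j = g' j" for j
      using eq[of j] fg by (cases "j \<in> C") (auto simp: extensional_def)
    ultimately show "f = f' \<and> g = g'" by blast
  qed
  have sub: "merge ` D \<subseteq> {r \<in> V \<rightarrow>\<^sub>E {1..d}. word_weight r C = w}"
  proof clarify
    fix f g assume fg: "(f, g) \<in> D"
    have "merge (f, g) \<in> V \<rightarrow>\<^sub>E {1..d}"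
      using fg V(2) by (fastforce simp: D_def words_of_weight_def merge_def PiE_def extensional_def)
    moreover have "word_weight (merge (f, g)) C = w"
      using fg by (simp add: D_def words_of_weight_def word_weight_def merge_def)
    ultimately show "merge (f, g) \<in> V \<rightarrow>\<^sub>E {1..d} \<and> word_weight (merge (f, g)) C = w"
      by blast
  qed
  have "card D = card (words_of_weight d C w) * d ^ (card V - card C)"
    using V fin by (simp add: D_def card_cartesian_product card_PiE card_Diff_subset)
  moreover have "card D \<le> card {r \<in> V \<rightarrow>\<^sub>E {1..d}. word_weight r C = w}"
    using card_inj_on_le[OF inj sub] V(1) by (simp add: finite_PiE)
  ultimately show ?thesis by simp
qed

lemma card_rows_missing_weight:
  assumes V: "finite V" "C \<subseteq> V" and d: "d \<ge> 2" and w: "card C < w" "w < d * card C"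
  shows "real (card {r \<in> V \<rightarrow>\<^sub>E {1..d}. word_weight r C \<noteq> w})
           \<le> real d ^ card V * (1 - real (card C) / real d ^ card C)"
proof -
  define R where "R = V \<rightarrow>\<^sub>E {1..d}"
  have finR: "finite R" using V by (simp add: R_def finite_PiE)
  have cardR: "card R = d ^ card V" using V by (simp add: R_def card_PiE)
  have fin: "finite C" using V finite_subset by blast
  have le: "card C \<le> card V" using V by (rule card_mono)
  have "card C * d ^ (card V - card C) \<le> card (words_of_weight d C w) * d ^ (card V - card C)"
    using card_words_of_weight_ge[OF fin d w] by simp
  also have "\<dots> \<le> card {r \<in> R. word_weight r C = w}"
    unfolding R_def by (rule card_rows_of_weight[OF V])
  finally have hit: "real (card C) * real d ^ (card V - card C) \<le> card {r \<in> R. word_weight r C = w}"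
    by (metis of_nat_le_iff of_nat_mult of_nat_power)
  have "card R = card {r \<in> R. word_weight r C = w} + card {r \<in> R. word_weight r C \<noteq> w}"
    using finR by (subst card_Un_disjoint[symmetric]) (auto intro: arg_cong[where f = card])
  then have "real (card R)
      = real (card {r \<in> R. word_weight r C = w}) + real (card {r \<in> R. word_weight r C \<noteq> w})"
    by (simp only: of_nat_add)
  then have "real (card {r \<in> R. word_weight r C \<noteq> w})
      = real d ^ card V - card {r \<in> R. word_weight r C = w}"
    by (simp add: cardR)
  also have "\<dots> \<le> real d ^ card V - real (card C) * real d ^ (card V - card C)"
    using hit by simp
  also have "\<dots> = real d ^ card V * (1 - real (card C) / real d ^ card C)"
    using d le by (simp add: power_diff right_diff_distrib)
  finally show ?thesis by (simp add: R_def)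
qed

lemma less_power_self:
  assumes "d \<ge> 2"
  shows "real t < real d ^ t"
proof -
  have "t < d ^ t"
    using less_exp[of t] power_mono[of 2 d t] assms by linarith
  then show ?thesis by (metis of_nat_less_iff of_nat_power)
qed

section \<open>Averaging and alteration\<close>

text \<open>
  Only weights strictly between the extremes are recorded, since constant rows take care of the
  other two.
\<close>

definition uncovered :: "nat \<Rightarrow> nat \<Rightarrow> nat \<Rightarrow> nat \<Rightarrow> (nat \<Rightarrow> nat \<Rightarrow> nat) \<Rightarrow> (nat set \<times> nat) set" where
  "uncovered k N t d A =
     {(C, w). (C \<subseteq> {..<N} \<and> card C = t \<and> t < w \<and> w < d * t) \<and> (\<forall>i<k. word_weight (A i) C \<noteq> w)}"

text \<open>
  The probabilistic argument in counting form: summing the number of uncovered pairs over all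
  \<open>k \<times> N\<close> arrays and exchanging the sums shows that its mean is at most \<open>m\<close>, because the arrays
  that leave a given pair uncovered are those all of whose rows miss it.
\<close>

lemma array_with_few_uncovered:
  assumes d: "d \<ge> 2"
    and m: "real N ^ t * real (d * t) * (1 - real t / real d ^ t) ^ k \<le> real m"
  obtains A where "\<And>i j. i < k \<Longrightarrow> j < N \<Longrightarrow> A i j \<in> {1..d}" "card (uncovered k N t d A) \<le> m"
proof -
  define q where "q = 1 - real t / real d ^ t"
  define R where "R = {..<N} \<rightarrow>\<^sub>E {1..d}"
  define X where "X = {..<k} \<rightarrow>\<^sub>E R"
  define Q where "Q = {C. C \<subseteq> {..<N} \<and> card C = t} \<times> {t<..<d * t}"
  define miss where "miss = (\<lambda>A (C, w). \<forall>i<k. word_weight (A i) C \<noteq> w)"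
  have finR: "finite R" and cardR: "card R = d ^ N"
    by (simp_all add: R_def finite_PiE card_PiE)
  have finX: "finite X" and cardX: "card X = (d ^ N) ^ k"
    using finR by (simp_all add: X_def finite_PiE card_PiE cardR)
  have X_pos: "0 < card X" using d by (simp add: cardX)
  have finQ: "finite Q" by (simp add: Q_def)
  have q0: "0 \<le> q"
    using less_power_self[OF d, of t] d by (simp add: q_def)
  have unc: "uncovered k N t d A = {p \<in> Q. miss A p}" for A
    by (auto simp: uncovered_def Q_def miss_def)
  have cardQ: "real (card Q) \<le> real N ^ t * real (d * t)"
  proof -
    have "card Q = (N choose t) * card {t<..<d * t}"
      by (simp add: Q_def card_cartesian_product n_subsets)
    also have "\<dots> \<le> N ^ t * (d * t)"
    proof (intro mult_mono)
      show "N choose t \<le> N ^ t"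
        by (cases "t \<le> N") (simp_all add: binomial_le_pow binomial_eq_0)
    qed simp_all
    finally show ?thesis by (metis of_nat_le_iff of_nat_mult of_nat_power)
  qed
  have miss_card: "real (card {A \<in> X. miss A p}) \<le> real (card X) * q ^ k" if "p \<in> Q" for p
  proof -
    obtain C w where p: "p = (C, w)" "C \<subseteq> {..<N}" "card C = t" "t < w" "w < d * t"
      using \<open>p \<in> Q\<close> by (auto simp: Q_def)
    have "{A \<in> X. miss A p} = {..<k} \<rightarrow>\<^sub>E {r \<in> R. word_weight r C \<noteq> w}"
      unfolding X_def miss_def p(1) by (simp add: PiE_iff set_eq_iff) blast
    then have "real (card {A \<in> X. miss A p}) = real (card {r \<in> R. word_weight r C \<noteq> w}) ^ k"
      by (simp add: card_PiE)
    also have "\<dots> \<le> (real d ^ N * q) ^ k"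
      using card_rows_missing_weight[of "{..<N}" C d w] d p
      by (intro power_mono) (simp_all add: R_def q_def)
    finally show ?thesis by (simp add: cardX power_mult_distrib)
  qed
  have "\<exists>A\<in>X. card (uncovered k N t d A) \<le> m"
  proof (rule ccontr)
    assume "\<not> ?thesis"
    then have "\<And>A. A \<in> X \<Longrightarrow> Suc m \<le> card (uncovered k N t d A)" by (simp add: not_le Suc_le_eq)
    then have "card X * Suc m \<le> (\<Sum>A\<in>X. card (uncovered k N t d A))"
      using sum_bounded_below[of X "Suc m" "\<lambda>A. card (uncovered k N t d A)"] by simp
    also have "\<dots> = (\<Sum>p\<in>Q. card {A \<in> X. miss A p})"
      unfolding unc using sum.swap_restrict[OF finX finQ, of "\<lambda>_ _. 1 :: nat" miss] by simp
    finally have "real (card X * Suc m) \<le> real (\<Sum>p\<in>Q. card {A \<in> X. miss A p})"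
      by (simp only: of_nat_le_iff)
    also have "\<dots> = (\<Sum>p\<in>Q. real (card {A \<in> X. miss A p}))" by simp
    also have "\<dots> \<le> real (card Q) * (real (card X) * q ^ k)"
      using sum_bounded_above[of Q "\<lambda>p. real (card {A \<in> X. miss A p})"] miss_card by simp
    also have "\<dots> \<le> (real N ^ t * real (d * t)) * (real (card X) * q ^ k)"
      using cardQ q0 by (intro mult_right_mono) auto
    also have "\<dots> = real (card X) * (real N ^ t * real (d * t) * q ^ k)"
      by (simp only: mult_ac)
    also have "\<dots> \<le> real (card X) * real m"
      using m by (intro mult_left_mono) (simp_all add: q_def)
    finally have "real (card X) * real (Suc m) \<le> real (card X) * real m" by simp
    then show False using X_pos by simp
  qed
  then obtain A where A: "A \<in> X" "card (uncovered k N t d A) \<le> m" by blast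
  show thesis
  proof (rule that[OF _ A(2)])
    fix i j assume "i < k" "j < N"
    then have "A i \<in> R" using A(1) PiE_mem[of A "{..<k}" "\<lambda>_. R" i] by (simp add: X_def)
    then show "A i j \<in> {1..d}"
      using \<open>j < N\<close> PiE_mem[of "A i" "{..<N}" "\<lambda>_. {1..d}" j] by (simp add: R_def)
  qed
qed

text \<open>
  Alteration: deleting one column of each uncovered choice from an array with \<open>2 * n\<close> columns
  destroys all of them and leaves at least \<open>n\<close> columns.
\<close>

lemma k0_le:
  assumes t: "t > 0" and d: "d \<ge> 2"
    and small: "real (2 * n) ^ t * real (d * t) * (1 - real t / real d ^ t) ^ k \<le> real n"
  shows "k0 n t d \<le> k + 2"
proof -
  obtain A where A: "\<And>i j. i < k \<Longrightarrow> j < 2 * n \<Longrightarrow> A i j \<in> {1..d}"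
    and few: "card (uncovered k (2 * n) t d A) \<le> n"
    using array_with_few_uncovered[OF d small] by blast
  define U where "U = uncovered k (2 * n) t d A"
  have finU: "finite U"
    by (rule finite_subset[of _ "Pow {..<2 * n} \<times> {..<d * t}"]) (auto simp: U_def uncovered_def)
  define pick :: "nat set \<times> nat \<Rightarrow> nat" where "pick = (\<lambda>(C, w). SOME c. c \<in> C)"
  have pick: "pick (C, w) \<in> C" if "(C, w) \<in> U" for C w
  proof -
    have "C \<noteq> {}" using that t by (auto simp: U_def uncovered_def)
    then show ?thesis by (simp add: pick_def some_in_eq)
  qed
  define S where "S = {..<2 * n} - pick ` U"
  have "card (pick ` U) \<le> n" using card_image_le[OF finU, of pick] few by (simp add: U_def)
  then have "n \<le> card S"
    using diff_card_le_card_Diff[of "pick ` U" "{..<2 * n}"] finU by (simp add: S_def)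
  then obtain g where g: "inj_on g {..<n}" "g ` {..<n} \<subseteq> S"
    using card_le_inj[of "{..<n}" S] by (auto simp: S_def)
  define B where
    "B i j = (if i < k then A i (g j) else if i = k then 1 else d)" for i j
  have "weight_covering_array (k + 2) n t d B"
    unfolding weight_covering_array_def
  proof (intro conjI allI impI)
    fix i j assume "j < n"
    then have "g j < 2 * n" using g(2) by (auto simp: S_def)
    then show "B i j \<in> {1..d}" using A[of i "g j"] d by (auto simp: B_def)
  next
    fix C w assume Cw: "C \<subseteq> {..<n} \<and> card C = t \<and> t \<le> w \<and> w \<le> d * t"
    consider "w = t" | "w = d * t" | "t < w" "w < d * t" using Cw by linarith
    then show "\<exists>i<k + 2. word_weight (B i) C = w"
    proof cases
      case 1
      then show ?thesis using Cw by (intro exI[of _ k]) (simp add: B_def word_weight_def)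
    next
      case 2
      then show ?thesis using Cw by (intro exI[of _ "k + 1"]) (simp add: B_def word_weight_def)
    next
      case 3
      have injC: "inj_on g C" using g(1) Cw inj_on_subset by blast
      have gC: "g ` C \<subseteq> S" using g(2) Cw by blast
      then have "(g ` C, w) \<notin> U" using pick[of "g ` C" w] unfolding S_def by blast
      moreover have "card (g ` C) = t" using Cw injC by (simp add: card_image)
      ultimately obtain i where i: "i < k" "word_weight (A i) (g ` C) = w"
        using gC 3 by (auto simp: U_def uncovered_def S_def)
      have "word_weight (B i) C = w"
        using i injC by (simp add: B_def word_weight_def sum.reindex)
      then show ?thesis using i(1) by (intro exI[of _ i]) simp
    qed
  qed
  then show ?thesis unfolding k0_def by (intro Least_le) blast
qed

section \<open>Asymptotics\<close>

theorem theorem3p1: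
  fixes t d :: nat
  assumes "t \<ge> 2" and "d \<ge> 2"
  shows "\<exists>\<epsilon> :: nat \<Rightarrow> real. \<epsilon> \<longlonglongrightarrow> 0 \<and>
           (\<forall>\<^sub>F n in sequentially.
              real (k0 n t d) \<le>
                (real t - 1) * log 2 (real n) / log 2 (real d ^ t / (real d ^ t - real t)) * (1 + \<epsilon> n))"
proof -
  define q where "q = 1 - real t / real d ^ t"
  define L where "L = log 2 (real d ^ t / (real d ^ t - real t))"
  define b where "b = real t + log 2 (real (d * t))"
  \<comment> \<open>The 3 pays for rounding the number of random rows up and for the two constant rows.\<close>
  define c where "c = b / L + 3"
  define \<epsilon> where "\<epsilon> n = c * L / (real t - 1) / log 2 (real n)" for n :: nat
  have td: "real t < real d ^ t" using assms(2) by (rule less_power_self)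
  have dt0: "0 < real d ^ t" using assms by simp
  have q: "0 < q" "q < 1" using td dt0 assms by (simp_all add: q_def)
  have "real d ^ t / (real d ^ t - real t) = inverse q"
    using td dt0 by (simp add: q_def field_simps)
  then have L: "L = - log 2 q" using q by (simp add: L_def log_inverse)
  have L0: "0 < L" using q by (simp add: L)
  have b0: "0 \<le> b"
  proof -
    have "1 \<le> d * t" using assms by simp
    then have "0 \<le> log 2 (real (d * t))" by (simp del: of_nat_mult)
    then show ?thesis by (simp add: b_def)
  qed
  have bound: "real (k0 n t d) \<le> (real t - 1) * log 2 (real n) / L * (1 + \<epsilon> n)" if n: "n \<ge> 2" for n
  proof -
    define l where "l = log 2 (real n)"
    have l0: "0 < l" using n by (simp add: l_def)
    \<comment> \<open>\<open>y\<close> solves \<open>(2 * n) ^ t * (d * t) * q powr y = n\<close>.\<close>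
    define y where "y = ((real t - 1) * l + b) / L"
    define k where "k = nat \<lceil>y\<rceil>"
    have y0: "0 \<le> y" using l0 b0 L0 assms by (simp add: y_def)
    have k: "y \<le> real k" "real k \<le> y + 1" using y0 unfolding k_def by linarith+
    have "real (2 * n) ^ t * real (d * t) * q ^ k \<le> real n"
    proof -
      have pos: "0 < real (2 * n) ^ t * real (d * t) * q ^ k"
        using n q assms by simp
      have "log 2 (real (2 * n) ^ t * real (d * t) * q ^ k)
          = real t * (1 + l) + log 2 (real (d * t)) - real k * L"
        using n q assms by (simp add: log_mult log_nat_power L l_def algebra_simps)
      also have "\<dots> = l + (y - real k) * L"
        using L0 by (simp add: y_def b_def field_simps)
      also have "\<dots> \<le> l" using k(1) L0 by (simp add: mult_le_0_iff)
      finally show ?thesis using pos n by (simp add: l_def)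
    qed
    then have "k0 n t d \<le> k + 2"
      using assms by (intro k0_le) (simp_all add: q_def)
    then have "real (k0 n t d) \<le> real k + 2" by linarith
    also have "\<dots> \<le> (real t - 1) * l / L + c"
      using k(2) by (simp add: y_def c_def add_divide_distrib)
    also have "\<dots> = (real t - 1) * l / L * (1 + \<epsilon> n)"
      using l0 L0 assms by (simp add: \<epsilon>_def l_def[symmetric] distrib_left)
    finally show ?thesis by (simp add: l_def)
  qed
  have "filterlim (\<lambda>n. log 2 (real n)) at_top sequentially"
    unfolding log_def divide_inverse
    by (intro filterlim_at_top_mult_tendsto_pos[OF tendsto_const]
          filterlim_compose[OF ln_at_top filterlim_real_sequentially]) simp
  then have "\<epsilon> \<longlonglongrightarrow> 0"
    unfolding \<epsilon>_def
    by (intro tendsto_divide_0[OF tendsto_const] filterlim_at_top_imp_at_infinity)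
  moreover have "\<forall>\<^sub>F n in sequentially.
      real (k0 n t d) \<le> (real t - 1) * log 2 (real n) / L * (1 + \<epsilon> n)"
    using bound by (intro eventually_sequentiallyI[of 2])
  ultimately show ?thesis unfolding L_def by blast
qed

end
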